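(* Let $F=\frac1n\sum_{i=1}^nF_i$, where each $F_i:\mathbb{R}^d\to\mathbb{R}^d$ is $L_i$-Lipschitz ($L_i>0$) and satisfies $\langle F_i(x)-F_i(x^* ),x-x^*\rangle\ge\mu_i\|x-x^*\|^2$ for all $x$, with (possibly negative) $\mu_i\in\mathbb{R}$, $|\mu_i|\le L_i$. Assume $\overline\mu=\frac1n\sum_{i:\mu_i\ge0}\mu_i+\frac4n\sum_{i:\mu_i<0}\mu_i>0$. Let $\xi^k$ be sampled from $\{1,\dots,n\}$ with $\mathbb{P}[\xi^k=i]=L_i/\sum_{j=1}^nL_j$, and let $\overline L=\frac1n\sum_{i=1}^nL_i$, $\sigma_{IS*}^2=\frac1n\sum_{i=1}^n\frac{\overline L}{L_i}\|F_i(x^* )\|^2$. Let $K\ge0$, $k_0=\lceil K/2\rceil$, and define $\{\beta_k\}_{k\ge0}$ by: $\beta_k=1$ if $K\le\frac{48\overline L}{\overline\mu}$; $\beta_k=1$ if $K>\frac{48\overline L}{\overline\mu}$ and $k<k_0$; $\beta_k=\dfrac{96\overline L}{96\overline L+\overline\mu(k-k_0)}$ if $K>\frac{48\overline L}{\overline\mu}$ and $k\ge k_0$. Then the iterates of S-SEG with $\gamma_{1,\xi^k}=\frac{\beta_k}{6L_{\xi^k}}$ and $\gamma_{2,\xi^k}=\frac14\gamma_{1,\xi^k}$ satisfy $$\mathbb{E}\left[\|x^K-x^*\|^2\right]\le\frac{1536\overline L\|x^0-x^*\|^2}{\overline\mu}\exp\left(-\frac{\overline\mu K}{96\overline L}\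right)+\frac{1728\sigma_{IS*}^2}{\overline\mu^2K}.$$
   Context: $x^*\in\mathbb{R}^d$ satisfies $F(x^* )=0$, $\|\cdot\|$ is the Euclidean norm. The samples $\xi^0,\xi^1,\dots$ are independent. Same-sample stochastic extragradient (S-SEG), started at a deterministic $x^0$, is $x^{k+1}=x^k-\gamma_{2,\xi^k}F_{\xi^k}(x^k-\gamma_{1,\xi^k}F_{\xi^k}(x^k))$, $k\ge0$. *)

theory Defs
  imports "HOL-Probability.Probability"
begin

definition mean_op :: "nat \<Rightarrow> (nat \<Rightarrow> 'v \<Rightarrow> 'v) \<Rightarrow> 'v \<Rightarrow> 'v::real_vector" where
  "mean_op n Fs x = (1 / real n) *\<^sub>R (\<Sum>i=1..n. Fs i x)"

definition mean_L :: "nat \<Rightarrow> (nat \<Rightarrow> real) \<Rightarrow> real" where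
  "mean_L n L = (1 / real n) * (\<Sum>i=1..n. L i)"

definition mu_bar :: "nat \<Rightarrow> (nat \<Rightarrow> real) \<Rightarrow> real" where
  "mu_bar n \<mu> =
     (1 / real n) * (\<Sum>i\<in>{i\<in>{1..n}. \<mu> i \<ge> 0}. \<mu> i)
     + (4 / real n) * (\<Sum>i\<in>{i\<in>{1..n}. \<mu> i < 0}. \<mu> i)"

definition sigma_IS_sq ::
  "nat \<Rightarrow> (nat \<Rightarrow> real) \<Rightarrow> (nat \<Rightarrow> 'v \<Rightarrow> 'v) \<Rightarrow> 'v::real_normed_vector \<Rightarrow> real" where
  "sigma_IS_sq n L Fs xs =
     (1 / real n) * (\<Sum>i=1..n. mean_L n L / L i * (norm (Fs i xs))\<^sup>2)"

text \<open>The schedule depends on the horizon \<open>K\<close>; \<open>Lb\<close> and \<open>mb\<close> stand for the averaged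
  constants \<open>mean_L n L\<close> and \<open>mu_bar n \<mu>\<close>.\<close>

definition half_horizon :: "nat \<Rightarrow> nat" where
  "half_horizon K = nat \<lceil>real K / 2\<rceil>"

definition beta_schedule :: "real \<Rightarrow> real \<Rightarrow> nat \<Rightarrow> nat \<Rightarrow> real" where
  "beta_schedule Lb mb K k =
     (if real K \<le> 48 * Lb / mb then 1
      else if k < half_horizon K then 1
      else 96 * Lb / (96 * Lb + mb * (real k - real (half_horizon K))))"

text \<open>The same sample \<open>s k\<close> is used for both evaluations in step \<open>k\<close>. The step sizes
  \<open>g1 k i\<close> and \<open>g2 k i\<close> depend on the iteration \<open>k\<close> and on the sampled index \<open>i\<close>.\<close>

primrec S_SEG ::
  "(nat \<Rightarrow> 'v \<Rightarrow> 'v) \<Rightarrow> (nat \<Rightarrow> nat \<Rightarrow> real) \<Rightarrow> (nat \<Rightarrow> nat \<Rightarrow> real) \<Rightarrow> 'v::real_vector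
    \<Rightarrow> (nat \<Rightarrow> nat) \<Rightarrow> nat \<Rightarrow> 'v" where
  "S_SEG Fs g1 g2 x0 s 0 = x0"
| "S_SEG Fs g1 g2 x0 s (Suc k) =
     (let x = S_SEG Fs g1 g2 x0 s k
      in x - g2 k (s k) *\<^sub>R Fs (s k) (x - g1 k (s k) *\<^sub>R Fs (s k) x))"

end

theory Submission
  imports Defs
begin

text \<open>A single step with sample \<open>i\<close> and exploration step \<open>\<gamma>\<close> contracts the squared distance to
  \<open>xs\<close> by \<open>1 - \<gamma> \<mu>' / 4\<close>, where \<open>\<mu>' = \<mu> i\<close> or \<open>4 \<mu> i\<close> according to the sign of \<open>\<mu> i\<close>, up to
  a term linear in \<open>Fs i xs\<close> and a noise \<open>\<gamma>\<^sup>2 |Fs i xs|\<^sup>2\<close> (\<open>extragradient_step\<close>). Importance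
  sampling with \<open>\<gamma> = \<beta> / (6 L i)\<close> makes the linear term vanish on average, because
  the \<open>Fs i xs\<close> sum to zero (\<open>importance_sampled_step\<close>). Single factors \<open>1 - \<gamma> \<mu>' / 4\<close> may exceed \<open>1\<close>,
  but their mean is \<open>1 - \<beta> / H\<close> with \<open>H = 24 mean_L / mu_bar\<close>.

  The next sample is independent of the current iterate, which is a function of the earlier samples
  (\<open>expectation_fresh_sample\<close>). So \<open>r k\<close>, the mean squared distance after \<open>k\<close> steps, satisfies
  \<open>r (k + 1) \<le> (1 - \<beta> k / H) r k + c (\<beta> k)\<^sup>2\<close> with \<open>c = sigma_IS_sq / (36 mean_L\<^sup>2)\<close>.
  This scalar recursion is solved in \<open>beta_schedule_recursion\<close>: while \<open>\<beta> = 1\<close> the error decays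
  geometrically down to a noise floor \<open>c H\<close>, and afterwards \<open>\<beta> = 4 H / (4 H + j)\<close> drives the
  floor down to order \<open>H\<^sup>2 c / K\<close>. The result is
  \<open>r K \<le> exp (- K / (2 H)) r 0 + 64 H\<^sup>2 c / K\<close>. Substituting \<open>H\<close> and \<open>c\<close>, the exponent becomes
  \<open>mu_bar K / (48 mean_L)\<close> and the noise constant \<open>1024\<close>, so the claimed bound follows with room to
  spare.\<close>

section \<open>One extragradient step with a fixed sample\<close>

text \<open>Write \<open>u = G x\<close>, \<open>v = G (x - \<gamma> u)\<close>, \<open>f = G xs\<close> and \<open>R = x - xs\<close>. Everything rests on a lower
  bound for \<open>2 \<gamma> \<langle>v, R\<rangle>\<close>, obtained by splitting \<open>R\<close> into \<open>R - \<gamma> u\<close>, against which monotonicity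
  applies to \<open>v - f\<close>, and \<open>\<gamma> u\<close>, where \<open>2 \<langle>v, u\<rangle> = |v|\<^sup>2 + |u|\<^sup>2 - |v - u|\<^sup>2\<close> gains a full
  \<open>\<gamma>\<^sup>2 |u|\<^sup>2\<close>. This gain pays for all errors in \<open>\<gamma>\<^sup>2 |u|\<^sup>2\<close>: at most \<open>1/36\<close> of it for the Lipschitz
  bound on \<open>v - u\<close>, \<open>2/3\<close> for replacing \<open>R - \<gamma> u\<close> by \<open>R\<close> in the monotonicity term, and \<open>1/4\<close>
  for the cross term of \<open>f\<close> and \<open>u\<close>. The replacement loses a factor \<open>2\<close> against \<open>2 \<gamma> \<mu>\<close> when
  \<open>\<mu> \<ge> 0\<close> and gains one when \<open>\<mu> < 0\<close>; hence the weights \<open>1\<close> and \<open>4\<close>. The term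
  in \<open>\<langle>G xs, R\<rangle>\<close> is kept exactly because it cancels on average.\<close>

lemma extragradient_step:
  fixes G :: "'v::real_inner \<Rightarrow> 'v"
  assumes lip: "L-lipschitz_on UNIV G"
    and mono: "\<And>x. (G x - G xs) \<bullet> (x - xs) \<ge> \<mu> * (norm (x - xs))\<^sup>2"
    and mu_L: "\<bar>\<mu>\<bar> \<le> L"
    and \<gamma>: "\<gamma> \<ge> 0" "\<gamma> * L \<le> 1 / 6"
  shows "(norm (x - (\<gamma> / 4) *\<^sub>R G (x - \<gamma> *\<^sub>R G x) - xs))\<^sup>2
       \<le> (1 - \<gamma> / 4 * (if \<mu> \<ge> 0 then \<mu> else 4 * \<mu>)) * (norm (x - xs))\<^sup>2
         - \<gamma> / 2 * (G xs \<bullet> (x - xs)) + \<gamma>\<^sup>2 * (norm (G xs))\<^sup>2"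
proof -
  define u v f R where "u = G x" and "v = G (x - \<gamma> *\<^sub>R G x)" and "f = G xs" and "R = x - xs"
  define \<mu>' where "\<mu>' = (if \<mu> \<ge> 0 then \<mu> else 4 * \<mu>)"
  define U where "U = \<gamma>\<^sup>2 * (u \<bullet> u)"
  have "L \<ge> 0"
    using mu_L by linarith
  have "U \<ge> 0"
    by (simp add: U_def)
  have lookahead: "x - \<gamma> *\<^sub>R u - xs = R - \<gamma> *\<^sub>R u"
    by (simp add: R_def)
  have monotone: "\<mu> * (norm (R - \<gamma> *\<^sub>R u))\<^sup>2 \<le> (v - f) \<bullet> (R - \<gamma> *\<^sub>R u)"
    using mono[of "x - \<gamma> *\<^sub>R u"] unfolding lookahead v_def f_def u_def[symmetric] .
  \<comment> \<open>Here and in the next bound \<open>\<gamma> L \<le> 1/6\<close> keeps the error below a fixed fraction of \<open>U\<close>.\<close>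
  have drift: "\<gamma>\<^sup>2 * ((v - u) \<bullet> (v - u)) \<le> U / 36"
  proof -
    have "norm (v - u) \<le> L * (\<gamma> * norm u)"
      using lipschitz_onD[OF lip, of "x - \<gamma> *\<^sub>R u" x] \<gamma>
      by (simp add: u_def v_def dist_norm)
    also have "\<dots> = (\<gamma> * L) * norm u"
      by simp
    also have "\<dots> \<le> 1 / 6 * norm u"
      using \<gamma> by (intro mult_right_mono) auto
    finally have "(norm (v - u))\<^sup>2 \<le> (1 / 6 * norm u)\<^sup>2"
      by (intro power_mono) auto
    then have "(v - u) \<bullet> (v - u) \<le> u \<bullet> u / 36"
      by (simp add: power_mult_distrib power2_norm_eq_inner power_divide)
    from mult_left_mono[OF this, of "\<gamma>\<^sup>2"] show ?thesis
      by (simp add: U_def)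
  qed
  have curvature: "\<gamma> * \<mu>' * (R \<bullet> R) - 2 / 3 * U \<le> 2 * \<gamma> * \<mu> * (norm (R - \<gamma> *\<^sub>R u))\<^sup>2"
  proof (cases "\<mu> \<ge> 0")
    case True
    \<comment> \<open>\<open>|R|\<^sup>2 \<le> 2 |R - \<gamma> u|\<^sup>2 + 2 |\<gamma> u|\<^sup>2\<close>, written as a square.\<close>
    have "(norm (R - 2 *\<^sub>R \<gamma> *\<^sub>R u))\<^sup>2 \<ge> 0"
      by simp
    then have "R \<bullet> R / 2 - U \<le> (norm (R - \<gamma> *\<^sub>R u))\<^sup>2"
      unfolding power2_norm_eq_inner U_def
      by (simp add: inner_simps inner_commute power2_eq_square)
    then have "2 * \<gamma> * \<mu> * (R \<bullet> R / 2 - U) \<le> 2 * \<gamma> * \<mu> * (norm (R - \<gamma> *\<^sub>R u))\<^sup>2"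
      using True \<gamma> by (intro mult_left_mono) auto
    moreover have "\<gamma> * \<mu> * U \<le> 1 / 6 * U"
      using \<open>U \<ge> 0\<close> mult_left_mono[OF abs_le_D1[OF mu_L] \<gamma>(1)] \<gamma>(2)
      by (intro mult_right_mono) auto
    ultimately show ?thesis
      using True \<open>U \<ge> 0\<close> by (simp add: \<mu>'_def algebra_simps)
  next
    case False
    \<comment> \<open>\<open>|R - \<gamma> u|\<^sup>2 \<le> 2 |R|\<^sup>2 + 2 |\<gamma> u|\<^sup>2\<close>, written as a square.\<close>
    have "(norm (R + \<gamma> *\<^sub>R u))\<^sup>2 \<ge> 0"
      by simp
    then have "(norm (R - \<gamma> *\<^sub>R u))\<^sup>2 \<le> 2 * (R \<bullet> R) + 2 * U"
      unfolding power2_norm_eq_inner U_def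
      by (simp add: inner_simps inner_commute power2_eq_square)
    then have "2 * \<gamma> * \<mu> * (2 * (R \<bullet> R) + 2 * U) \<le> 2 * \<gamma> * \<mu> * (norm (R - \<gamma> *\<^sub>R u))\<^sup>2"
      using False \<gamma> by (intro mult_left_mono_neg) (auto simp: mult_nonneg_nonpos)
    moreover have "\<gamma> * (- \<mu>) * U \<le> 1 / 6 * U"
      using \<open>U \<ge> 0\<close> mult_left_mono[OF abs_le_D2[OF mu_L] \<gamma>(1)] \<gamma>(2)
      by (intro mult_right_mono) auto
    ultimately show ?thesis
      using False by (simp add: \<mu>'_def algebra_simps)
  qed
  have young: "2 * \<gamma>\<^sup>2 * (f \<bullet> u) \<le> U / 4 + 4 * (\<gamma>\<^sup>2 * (f \<bullet> f))"
  proof -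
    have "(norm (u - 4 *\<^sub>R f))\<^sup>2 \<ge> 0"
      by simp
    then have "2 * (f \<bullet> u) \<le> u \<bullet> u / 4 + 4 * (f \<bullet> f)"
      unfolding power2_norm_eq_inner by (simp add: inner_simps inner_commute)
    from mult_left_mono[OF this, of "\<gamma>\<^sup>2"] show ?thesis
      by (simp add: U_def algebra_simps)
  qed
  have "2 * \<gamma> * \<mu> * (norm (R - \<gamma> *\<^sub>R u))\<^sup>2 \<le> 2 * \<gamma> * ((v - f) \<bullet> (R - \<gamma> *\<^sub>R u))"
    using mult_left_mono[OF monotone, of "2 * \<gamma>"] \<gamma> by (simp add: mult.assoc)
  moreover have "2 * \<gamma> * (v \<bullet> R) = 2 * \<gamma> * ((v - f) \<bullet> (R - \<gamma> *\<^sub>R u)) + 2 * \<gamma> * (f \<bullet> R)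
      - 2 * \<gamma>\<^sup>2 * (f \<bullet> u) + (\<gamma>\<^sup>2 * (v \<bullet> v) + U - \<gamma>\<^sup>2 * ((v - u) \<bullet> (v - u)))"
    unfolding U_def by (simp add: inner_simps inner_commute power2_eq_square algebra_simps)
  ultimately have progress: "\<gamma> * \<mu>' * (R \<bullet> R) + 2 * \<gamma> * (f \<bullet> R) - 4 * (\<gamma>\<^sup>2 * (f \<bullet> f))
      + \<gamma>\<^sup>2 * (v \<bullet> v) \<le> 2 * \<gamma> * (v \<bullet> R)"
    using drift curvature young \<open>U \<ge> 0\<close> by linarith
  \<comment> \<open>The update step is a quarter of \<open>\<gamma>\<close>, so the \<open>|v|\<^sup>2\<close> gained in \<open>progress\<close>, with weight \<open>1/4\<close>,
    absorbs the \<open>1/16\<close> created by squaring the update.\<close>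
  have "(norm (R - (\<gamma> / 4) *\<^sub>R v))\<^sup>2 = R \<bullet> R - 2 * \<gamma> * (v \<bullet> R) / 4 + \<gamma>\<^sup>2 * (v \<bullet> v) / 16"
    unfolding power2_norm_eq_inner
    by (simp add: inner_simps inner_commute power2_eq_square)
  moreover have "0 \<le> \<gamma>\<^sup>2 * (v \<bullet> v)"
    by simp
  moreover have "(1 - \<gamma> / 4 * \<mu>') * (R \<bullet> R) - \<gamma> / 2 * (f \<bullet> R)
      = R \<bullet> R - \<gamma> * \<mu>' * (R \<bullet> R) / 4 - 2 * \<gamma> * (f \<bullet> R) / 4"
    by (simp add: algebra_simps)
  ultimately have "(norm (R - (\<gamma> / 4) *\<^sub>R v))\<^sup>2
      \<le> (1 - \<gamma> / 4 * \<mu>') * (R \<bullet> R) - \<gamma> / 2 * (f \<bullet> R) + \<gamma>\<^sup>2 * (f \<bullet> f)"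
    using progress by linarith
  moreover have "x - (\<gamma> / 4) *\<^sub>R v - xs = R - (\<gamma> / 4) *\<^sub>R v"
    by (simp add: R_def)
  ultimately show ?thesis
    unfolding \<mu>'_def[symmetric] v_def[symmetric] f_def[symmetric] R_def[symmetric]
    by (simp only: power2_norm_eq_inner)
qed

section \<open>Averaging a step over the importance sampling\<close>

lemma mean_L_pos:
  assumes "n \<ge> 1" and "\<And>i. i \<in> {1..n} \<Longrightarrow> L i > 0"
  shows "mean_L n L > 0"
  using assms unfolding mean_L_def by (intro mult_pos_pos sum_pos) auto

lemma mu_bar_eq_sum:
  "real n * mu_bar n \<mu> = (\<Sum>i=1..n. if \<mu> i \<ge> 0 then \<mu> i else 4 * \<mu> i)"
proof -
  have "(\<Sum>i=1..n. if \<mu> i \<ge> 0 then \<mu> i else 4 * \<mu> i)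
      = (\<Sum>i\<in>{i\<in>{1..n}. \<mu> i \<ge> 0}. \<mu> i) + (\<Sum>i\<in>{i\<in>{1..n}. \<mu> i < 0}. 4 * \<mu> i)"
    by (subst sum.If_cases) (auto intro!: arg_cong2[where f = "(+)"] sum.cong)
  then show ?thesis
    by (cases "n = 0") (simp_all add: mu_bar_def sum_distrib_left field_simps)
qed

lemma mu_bar_le_mean_L:
  assumes "\<And>i. i \<in> {1..n} \<Longrightarrow> \<bar>\<mu> i\<bar> \<le> L i"
  shows "mu_bar n \<mu> \<le> mean_L n L"
proof (cases "n = 0")
  case False
  have "real n * mu_bar n \<mu> \<le> (\<Sum>i=1..n. L i)"
    unfolding mu_bar_eq_sum using assms by (intro sum_mono) fastforce
  then show ?thesis
    using False by (simp add: mean_L_def field_simps)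
qed (simp add: mu_bar_def mean_L_def)

text \<open>Sampling proportionally to \<open>L i\<close> cancels the \<open>1 / L i\<close> in the step size. So the mean of
  \<open>\<gamma> i *\<^sub>R Fs i xs\<close> is a multiple of \<open>mean_op n Fs xs = 0\<close>, and the curvatures average with equal
  weights into \<open>mu_bar\<close>. In the squared noise one factor \<open>1 / L i\<close> survives, which is the weight
  in \<open>sigma_IS_sq\<close>.\<close>

lemma importance_sampled_step:
  fixes Fs :: "nat \<Rightarrow> 'v::real_inner \<Rightarrow> 'v"
  assumes n: "n \<ge> 1"
    and zero: "mean_op n Fs xs = 0"
    and L_pos: "\<And>i. i \<in> {1..n} \<Longrightarrow> L i > 0"
    and lip: "\<And>i. i \<in> {1..n} \<Longrightarrow> (L i)-lipschitz_on UNIV (Fs i)"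
    and mono: "\<And>i x. i \<in> {1..n} \<Longrightarrow>
                 (Fs i x - Fs i xs) \<bullet> (x - xs) \<ge> \<mu> i * (norm (x - xs))\<^sup>2"
    and mu_L: "\<And>i. i \<in> {1..n} \<Longrightarrow> \<bar>\<mu> i\<bar> \<le> L i"
    and \<beta>: "0 \<le> \<beta>" "\<beta> \<le> 1"
    and \<gamma>: "\<And>i. \<gamma> i = \<beta> / (6 * L i)"
  shows "(\<Sum>i=1..n. L i / (\<Sum>j=1..n. L j)
            * (norm (x - (\<gamma> i / 4) *\<^sub>R Fs i (x - \<gamma> i *\<^sub>R Fs i x) - xs))\<^sup>2)
       \<le> (1 - \<beta> * mu_bar n \<mu> / (24 * mean_L n L)) * (norm (x - xs))\<^sup>2
         + sigma_IS_sq n L Fs xs / (36 * (mean_L n L)\<^sup>2) * \<beta>\<^sup>2"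
proof -
  define S where "S = (\<Sum>j=1..n. L j)"
  define \<mu>' where "\<mu>' i = (if \<mu> i \<ge> 0 then \<mu> i else 4 * \<mu> i)" for i
  define r where "r = (norm (x - xs))\<^sup>2"
  have "S > 0"
    unfolding S_def using n L_pos by (intro sum_pos) auto
  have "mean_L n L \<noteq> 0"
    using mean_L_pos[of n L] n L_pos by simp
  have S_eq: "S = real n * mean_L n L"
    using n by (simp add: S_def mean_L_def)
  have "(\<Sum>i=1..n. L i / S * (norm (x - (\<gamma> i / 4) *\<^sub>R Fs i (x - \<gamma> i *\<^sub>R Fs i x) - xs))\<^sup>2)
      \<le> (\<Sum>i=1..n. L i / S * ((1 - \<gamma> i / 4 * \<mu>' i) * r
            - \<gamma> i / 2 * (Fs i xs \<bullet> (x - xs)) + (\<gamma> i)\<^sup>2 * (norm (Fs i xs))\<^sup>2))"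
  proof (intro sum_mono mult_left_mono)
    fix i assume i: "i \<in> {1..n}"
    note L_pos[OF i]
    then show "L i / S \<ge> 0"
      using \<open>S > 0\<close> by simp
    have "\<gamma> i \<ge> 0" "\<gamma> i * L i \<le> 1 / 6"
      using \<open>L i > 0\<close> \<beta> by (auto simp: \<gamma>)
    then show "(norm (x - (\<gamma> i / 4) *\<^sub>R Fs i (x - \<gamma> i *\<^sub>R Fs i x) - xs))\<^sup>2
        \<le> (1 - \<gamma> i / 4 * \<mu>' i) * r - \<gamma> i / 2 * (Fs i xs \<bullet> (x - xs))
          + (\<gamma> i)\<^sup>2 * (norm (Fs i xs))\<^sup>2"
      unfolding \<mu>'_def r_def by (rule extragradient_step[OF lip[OF i] mono[OF i] mu_L[OF i]])
  qed
  also have "\<dots> = (\<Sum>i=1..n. L i * (r / S) - \<mu>' i * (\<beta> * r / (24 * S))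
      - (Fs i xs \<bullet> (x - xs)) * (\<beta> / (12 * S)) + (norm (Fs i xs))\<^sup>2 / L i * (\<beta>\<^sup>2 / (36 * S)))"
  proof (intro sum.cong refl)
    fix i assume "i \<in> {1..n}"
    then have "L i > 0"
      by (rule L_pos)
    then show "L i / S * ((1 - \<gamma> i / 4 * \<mu>' i) * r - \<gamma> i / 2 * (Fs i xs \<bullet> (x - xs))
          + (\<gamma> i)\<^sup>2 * (norm (Fs i xs))\<^sup>2)
        = L i * (r / S) - \<mu>' i * (\<beta> * r / (24 * S))
          - (Fs i xs \<bullet> (x - xs)) * (\<beta> / (12 * S)) + (norm (Fs i xs))\<^sup>2 / L i * (\<beta>\<^sup>2 / (36 * S))"
      using \<open>S > 0\<close> unfolding \<gamma> by (simp add: field_simps power2_eq_square)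
  qed
  also have "\<dots> = S * (r / S) - (real n * mu_bar n \<mu>) * (\<beta> * r / (24 * S))
      - ((\<Sum>i=1..n. Fs i xs) \<bullet> (x - xs)) * (\<beta> / (12 * S))
      + (\<Sum>i=1..n. (norm (Fs i xs))\<^sup>2 / L i) * (\<beta>\<^sup>2 / (36 * S))"
    unfolding mu_bar_eq_sum \<mu>'_def S_def
    by (simp only: sum.distrib sum_subtractf sum_distrib_right inner_sum_left)
  also have "(\<Sum>i=1..n. Fs i xs) = 0"
    using zero n by (simp add: mean_op_def)
  also have "(\<Sum>i=1..n. (norm (Fs i xs))\<^sup>2 / L i)
      = real n * sigma_IS_sq n L Fs xs / mean_L n L"
    using n \<open>mean_L n L \<noteq> 0\<close>
    by (simp add: sigma_IS_sq_def sum_divide_distrib sum_distrib_left)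
  also have "S * (r / S) - (real n * mu_bar n \<mu>) * (\<beta> * r / (24 * S))
      - (0 \<bullet> (x - xs)) * (\<beta> / (12 * S))
      + real n * sigma_IS_sq n L Fs xs / mean_L n L * (\<beta>\<^sup>2 / (36 * S))
      = (1 - \<beta> * mu_bar n \<mu> / (24 * mean_L n L)) * r
        + sigma_IS_sq n L Fs xs / (36 * (mean_L n L)\<^sup>2) * \<beta>\<^sup>2"
    using n \<open>mean_L n L \<noteq> 0\<close> unfolding S_eq by (simp add: field_simps power2_eq_square)
  finally show ?thesis
    unfolding S_def r_def .
qed

section \<open>Expectation over a fresh sample\<close>

lemma S_SEG_cong:
  assumes "\<And>j. j < k \<Longrightarrow> s j = s' j"
  shows "S_SEG Fs g1 g2 x0 s k = S_SEG Fs g1 g2 x0 s' k"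
  using assms by (induction k) simp_all

context prob_space
begin

text \<open>With finitely many possible values the first \<open>k\<close> samples range over a finite set of histories
  on which every subset is measurable. Hence any function of the history is measurable and
  bounded, whatever the operators are.\<close>

lemma past_measurable:
  assumes "indep_vars (\<lambda>_. count_space A) X UNIV" and "finite A"
  shows "(\<lambda>\<omega>. restrict (\<lambda>j. X j \<omega>) {..<k::nat}) \<in> M \<rightarrow>\<^sub>M count_space (Pi\<^sub>E {..<k} (\<lambda>_. A))"
proof -
  have "(\<lambda>\<omega>. restrict (\<lambda>j. X j \<omega>) {..<k}) \<in> M \<rightarrow>\<^sub>M Pi\<^sub>M {..<k} (\<lambda>_. count_space A)"
    using assms by (intro measurable_restrict) (auto simp: indep_vars_def)
  then show ?thesis
    using assms by (simp add: count_space_PiM_finite countable_finite)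
qed

lemma integrable_past:
  fixes h :: "(nat \<Rightarrow> 'b) \<Rightarrow> real"
  assumes "indep_vars (\<lambda>_. count_space A) X UNIV" and "finite A"
  shows "integrable M (\<lambda>\<omega>. h (restrict (\<lambda>j. X j \<omega>) {..<k}))"
proof -
  let ?E = "Pi\<^sub>E {..<k} (\<lambda>_. A)"
  note meas = past_measurable[OF assms, of k]
  have "finite ?E"
    using assms by (intro finite_PiE) auto
  have "AE \<omega> in M. norm (h (restrict (\<lambda>j. X j \<omega>) {..<k})) \<le> (\<Sum>s\<in>?E. \<bar>h s\<bar>)"
  proof (rule AE_I2)
    fix \<omega> assume "\<omega> \<in> space M"
    have "restrict (\<lambda>j. X j \<omega>) {..<k} \<in> ?E"
      using measurable_space[OF meas \<open>\<omega> \<in> space M\<close>] by simp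
    then show "norm (h (restrict (\<lambda>j. X j \<omega>) {..<k})) \<le> (\<Sum>s\<in>?E. \<bar>h s\<bar>)"
      using member_le_sum[of _ ?E "\<lambda>s. \<bar>h s\<bar>"] \<open>finite ?E\<close> by simp
  qed
  moreover have "(\<lambda>\<omega>. h (restrict (\<lambda>j. X j \<omega>) {..<k})) \<in> borel_measurable M"
    by (rule measurable_compose[OF meas]) simp
  ultimately show ?thesis
    by (rule integrable_const_bound)
qed

text \<open>The conditional expectation given the past, without conditioning: over a finite alphabet,
  splitting by the value \<open>i\<close> of the new sample leaves products of an indicator of \<open>X k = i\<close> and a
  function of the history, and these factors are independent.\<close>

lemma expectation_fresh_sample:
  fixes f :: "(nat \<Rightarrow> 'b) \<Rightarrow> 'b \<Rightarrow> real"
  assumes ind: "indep_vars (\<lambda>_. count_space A) X UNIV" and A: "finite A"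
  shows "expectation (\<lambda>\<omega>. f (restrict (\<lambda>j. X j \<omega>) {..<k}) (X k \<omega>))
       = (\<Sum>i\<in>A. prob {\<omega> \<in> space M. X k \<omega> = i}
            * expectation (\<lambda>\<omega>. f (restrict (\<lambda>j. X j \<omega>) {..<k}) i))"
proof -
  define Y where "Y \<omega> = restrict (\<lambda>j. X j \<omega>) {..<k}" for \<omega>
  have X: "X k \<in> M \<rightarrow>\<^sub>M count_space A"
    using ind by (auto simp: indep_vars_def)
  have meas_eq [measurable]: "{\<omega> \<in> space M. X k \<omega> = i} \<in> events" if "i \<in> A" for i
  proof -
    have "{\<omega> \<in> space M. X k \<omega> = i} = X k -` {i} \<inter> space M"
      by auto
    then show ?thesis
      using measurable_sets[OF X, of "{i}"] that by simp
  qed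
  have hit: "has_bochner_integral M (\<lambda>\<omega>. of_bool (X k \<omega> = i)) (prob {\<omega> \<in> space M. X k \<omega> = i})"
    if "i \<in> A" for i
  proof -
    have "has_bochner_integral M (indicat_real {\<omega> \<in> space M. X k \<omega> = i})
        (prob {\<omega> \<in> space M. X k \<omega> = i})"
      using meas_eq[OF that] by (intro has_bochner_integral_real_indicator) (auto simp: less_top[symmetric])
    then show ?thesis
      by (rule has_bochner_integral_cong[THEN iffD1, rotated -1]) auto
  qed
  have int: "integrable M (\<lambda>\<omega>. f (Y \<omega>) i)" for i
    unfolding Y_def by (rule integrable_past[OF ind A, where h = "\<lambda>s. f s i"])
  have indep: "indep_var borel (\<lambda>\<omega>. of_bool (X k \<omega> = i))
      borel (\<lambda>\<omega>. f (Y \<omega>) i)" if "i \<in> A" for i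
  proof -
    have "indep_var (Pi\<^sub>M {k} (\<lambda>_. count_space A)) (\<lambda>\<omega>. restrict (\<lambda>j. X j \<omega>) {k})
        (Pi\<^sub>M {..<k} (\<lambda>_. count_space A)) Y"
      unfolding Y_def by (rule indep_var_restrict[OF ind]) auto
    then have "indep_var borel ((\<lambda>s. of_bool (s k = i)) \<circ> (\<lambda>\<omega>. restrict (\<lambda>j. X j \<omega>) {k}))
        borel ((\<lambda>s. f s i) \<circ> Y)"
      by (rule indep_var_compose) (use A in \<open>simp_all add: count_space_PiM_finite countable_finite\<close>)
    then show ?thesis
      by (simp add: o_def)
  qed
  have "expectation (\<lambda>\<omega>. f (Y \<omega>) (X k \<omega>))
      = expectation (\<lambda>\<omega>. \<Sum>i\<in>A. of_bool (X k \<omega> = i) * f (Y \<omega>) i)"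
  proof (rule Bochner_Integration.integral_cong[OF refl])
    fix \<omega> assume \<omega>: "\<omega> \<in> space M"
    with X have "X k \<omega> \<in> A"
      by (auto dest: measurable_space)
    then show "f (Y \<omega>) (X k \<omega>)
        = (\<Sum>i\<in>A. of_bool (X k \<omega> = i) * f (Y \<omega>) i)"
      using A \<omega> by (simp add: indicator_def if_distrib[of "\<lambda>c. c * _"] sum.delta' cong: if_cong)
  qed
  also have "\<dots> = (\<Sum>i\<in>A. expectation (\<lambda>\<omega>. of_bool (X k \<omega> = i) * f (Y \<omega>) i))"
    by (intro Bochner_Integration.integral_sum indep_var_integrable[OF indep] int
        integrable.intros[OF hit])
  also have "\<dots> = (\<Sum>i\<in>A. prob {\<omega> \<in> space M. X k \<omega> = i} * expectation (\<lambda>\<omega>. f (Y \<omega>) i))"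
    by (intro sum.cong refl)
       (simp add: indep_var_lebesgue_integral[OF indep integrable.intros[OF hit] int]
          has_bochner_integral_integral_eq[OF hit])
  finally show ?thesis
    unfolding Y_def .
qed

end

section \<open>Solving the recursion for the switching step size schedule\<close>

lemma constant_step_recursion:
  fixes r :: "nat \<Rightarrow> real"
  assumes H: "H \<ge> 1" and c: "c \<ge> 0"
    and rec: "\<And>k. k < m \<Longrightarrow> r (Suc k) \<le> (1 - 1 / H) * r k + c"
    and "r 0 \<ge> 0"
  shows "r m \<le> exp (- (real m / H)) * r 0 + c * H"
proof -
  have contraction: "0 \<le> 1 - 1 / H" "1 - 1 / H \<le> exp (- (1 / H))"
    using H exp_ge_add_one_self[of "- (1 / H)"] by auto
  have "r k \<le> exp (- (real k / H)) * r 0 + c * H" if "k \<le> m" for k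
    using that
  proof (induction k)
    case 0
    then show ?case
      using H c by simp
  next
    case (Suc k)
    have "r (Suc k) \<le> (1 - 1 / H) * r k + c"
      using Suc by (intro rec) simp
    also have "\<dots> \<le> (1 - 1 / H) * (exp (- (real k / H)) * r 0 + c * H) + c"
      using Suc contraction by (intro add_right_mono mult_left_mono) auto
    also have "\<dots> = (1 - 1 / H) * (exp (- (real k / H)) * r 0) + c * H"
      using H by (simp add: field_simps)
    also have "\<dots> \<le> exp (- (1 / H)) * (exp (- (real k / H)) * r 0) + c * H"
      using contraction \<open>r 0 \<ge> 0\<close> by (intro add_right_mono mult_right_mono) auto
    also have "exp (- (1 / H)) * (exp (- (real k / H)) * r 0) = exp (- (real (Suc k) / H)) * r 0"
      by (simp add: exp_add[symmetric] mult.assoc[symmetric] add_divide_distrib)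
    finally show ?case .
  qed
  then show ?thesis
    by simp
qed

text \<open>With \<open>t = 4 H + j\<close>, the potential \<open>t\<^sup>2 r j\<close> grows only through the noise: the contraction
  \<open>1 - 4 / t\<close> beats the growth \<open>(t + 1)\<^sup>2 / t\<^sup>2\<close> of the weight, and the noise adds at most the
  constant \<open>32 H\<^sup>2 c\<close> per step.\<close>

lemma harmonic_step_recursion:
  fixes r :: "nat \<Rightarrow> real"
  assumes H: "H \<ge> 1" and c: "c \<ge> 0" and r: "\<And>j. r j \<ge> 0"
    and rec: "\<And>j. j < J \<Longrightarrow> r (Suc j) \<le> (1 - 4 / (4 * H + real j)) * r j
                + c * (4 * H / (4 * H + real j))\<^sup>2"
  shows "(4 * H + real J)\<^sup>2 * r J \<le> 16 * H\<^sup>2 * (r 0 + 2 * c * real J)"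
proof -
  have "(4 * H + real j)\<^sup>2 * r j \<le> 16 * H\<^sup>2 * (r 0 + 2 * c * real j)" if "j \<le> J" for j
    using that
  proof (induction j)
    case 0
    then show ?case
      by (simp add: power2_eq_square)
  next
    case (Suc j)
    define t where "t = 4 * H + real j"
    have t: "t \<ge> 4"
      using H by (simp add: t_def)
    have "(t + 1)\<^sup>2 * (1 - 4 / t) * t = t\<^sup>2 * t - (2 * t\<^sup>2 + 7 * t + 4)"
      using t by (simp add: field_simps power2_eq_square)
    also have "\<dots> \<le> t\<^sup>2 * t"
      using t zero_le_power2[of t] by linarith
    finally have weight: "(t + 1)\<^sup>2 * (1 - 4 / t) \<le> t\<^sup>2"
      using t by simp
    have "4 * t \<le> t\<^sup>2"
      using t unfolding power2_eq_square by (intro mult_right_mono) auto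
    moreover have "(t + 1)\<^sup>2 = t\<^sup>2 + 2 * t + 1"
      by (simp add: power2_sum)
    ultimately have "(t + 1)\<^sup>2 \<le> 2 * t\<^sup>2"
      using t by linarith
    then have noise: "(t + 1)\<^sup>2 / t\<^sup>2 \<le> 2"
      using t by (simp add: divide_le_eq)
    have "(t + 1)\<^sup>2 * r (Suc j) \<le> (t + 1)\<^sup>2 * ((1 - 4 / t) * r j + c * (4 * H / t)\<^sup>2)"
      using Suc rec[of j] by (intro mult_left_mono) (auto simp: t_def)
    also have "\<dots> = (t + 1)\<^sup>2 * (1 - 4 / t) * r j + 16 * H\<^sup>2 * c * ((t + 1)\<^sup>2 / t\<^sup>2)"
      by (simp add: algebra_simps power_divide power_mult_distrib)
    also have "\<dots> \<le> t\<^sup>2 * r j + 16 * H\<^sup>2 * c * 2"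
      using weight noise r c by (intro add_mono mult_right_mono mult_left_mono) auto
    also have "\<dots> \<le> 16 * H\<^sup>2 * (r 0 + 2 * c * real j) + 16 * H\<^sup>2 * c * 2"
      using Suc by (simp add: t_def)
    finally show ?case
      by (simp add: t_def algebra_simps)
  qed
  then show ?thesis
    by simp
qed

lemma half_horizon_bounds:
  "real K / 2 \<le> real (half_horizon K)" "real (half_horizon K) < real K / 2 + 1"
  "half_horizon K \<le> K"
  unfolding half_horizon_def by linarith+

lemma beta_schedule_bounds:
  assumes "Lb > 0" "mb > 0"
  shows "0 \<le> beta_schedule Lb mb K k" "beta_schedule Lb mb K k \<le> 1"
proof -
  have "0 \<le> mb * (real k - real (half_horizon K))" if "\<not> k < half_horizon K"
    using that assms by simp
  then show "0 \<le> beta_schedule Lb mb K k" "beta_schedule Lb mb K k \<le> 1"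
    using assms by (auto simp: beta_schedule_def divide_le_eq_1)
qed

text \<open>For a long horizon the constant first half removes the initial error exponentially fast and
  leaves a residual \<open>c H\<close>; the decaying second half then averages out this residual together
  with the new noise. For a horizon \<open>K \<le> 2 H\<close> the residual \<open>c H\<close> is itself
  of the order \<open>H\<^sup>2 c / K\<close>, and no decay is needed.\<close>

lemma beta_schedule_recursion:
  fixes r :: "nat \<Rightarrow> real" and Lb mb :: real
  defines "H \<equiv> 24 * Lb / mb"
  assumes mb: "mb > 0" "mb \<le> Lb" and c: "c \<ge> 0" and r: "\<And>k. r k \<ge> 0"
    and rec: "\<And>k. k < K \<Longrightarrow> r (Suc k)
        \<le> (1 - beta_schedule Lb mb K k / H) * r k + c * (beta_schedule Lb mb K k)\<^sup>2"
  shows "r K \<le> exp (- (real K / (2 * H))) * r 0 + 64 * H\<^sup>2 * c / real K"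
proof -
  have H: "H \<ge> 1"
    using mb by (simp add: H_def field_simps)
  have thr: "48 * Lb / mb = 2 * H"
    by (simp add: H_def)
  show ?thesis
  proof (cases "real K \<le> 2 * H")
    case True
    then have "beta_schedule Lb mb K k = 1" for k
      by (simp add: beta_schedule_def thr)
    then have "r K \<le> exp (- (real K / H)) * r 0 + c * H"
      using H c r rec by (intro constant_step_recursion) auto
    moreover have "exp (- (real K / H)) * r 0 \<le> exp (- (real K / (2 * H))) * r 0"
      using H r by (intro mult_right_mono) (auto simp: field_simps)
    moreover have "c * H \<le> 64 * H\<^sup>2 * c / real K" if "K > 0"
    proof -
      have "c * H * real K \<le> c * H * (2 * H)"
        using True H c by (intro mult_left_mono) auto
      also have "\<dots> \<le> 64 * H\<^sup>2 * c"
        using mult_nonneg_nonneg[OF c zero_le_power2[of H]] by (simp add: power2_eq_square mult_ac)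
      finally show ?thesis
        using that by (simp add: field_simps)
    qed
    \<comment> \<open>For \<open>K = 0\<close> the noise term is \<open>0\<close> by division by zero, and both sides are \<open>r 0\<close>.\<close>
    ultimately show ?thesis
      by (cases "K = 0") auto
  next
    case False
    define m J T where "m = half_horizon K" and "J = K - m" and "T = 4 * H + real J"
    note m = half_horizon_bounds[of K, folded m_def]
    have J: "real J = real K - real m" "m + J = K"
      using m by (simp_all add: J_def)
    have T: "T > 0" "real K \<le> 2 * T" "4 * H \<le> T"
      using m H J by (auto simp: T_def)
    have "K > 0"
      using False H by (cases K) auto
    have warmup: "r m \<le> exp (- (real m / H)) * r 0 + c * H"
    proof (rule constant_step_recursion[OF H c])
      show "r (Suc k) \<le> (1 - 1 / H) * r k + c" if "k < m" for k
        using rec[of k] that m False by (simp add: beta_schedule_def thr m_def)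
    qed (rule r)
    have "T\<^sup>2 * r (m + J) \<le> 16 * H\<^sup>2 * (r (m + 0) + 2 * c * real J)"
      unfolding T_def
    proof (rule harmonic_step_recursion[OF H c])
      show "r (m + Suc j) \<le> (1 - 4 / (4 * H + real j)) * r (m + j)
          + c * (4 * H / (4 * H + real j))\<^sup>2" if "j < J" for j
      proof -
        have "beta_schedule Lb mb K (m + j) = 4 * H / (4 * H + real j)"
          using False mb by (simp add: beta_schedule_def thr m_def) (simp add: H_def field_simps)
        then show ?thesis
          using rec[of "m + j"] that J H by simp
      qed
    qed (rule r)
    then have "r K \<le> 16 * H\<^sup>2 * (r m + 2 * c * real J) / T\<^sup>2"
      using T(1) J(2) by (simp add: pos_le_divide_eq mult.commute)
    also have "\<dots> \<le> 16 * H\<^sup>2 * (exp (- (real m / H)) * r 0 + c * H + 2 * c * real J) / T\<^sup>2"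
      using warmup by (intro divide_right_mono mult_left_mono) auto
    also have "\<dots> = (4 * H / T)\<^sup>2 * (exp (- (real m / H)) * r 0)
        + 16 * H\<^sup>2 * c * ((H + 2 * real J) / T\<^sup>2)"
      by (simp add: power_divide power_mult_distrib add_divide_distrib algebra_simps)
    also have "\<dots> \<le> 1 * (exp (- (real K / (2 * H))) * r 0) + 16 * H\<^sup>2 * c * (4 / real K)"
    proof (intro add_mono mult_mono mult_left_mono mult_right_mono)
      show "(4 * H / T)\<^sup>2 \<le> 1"
        using T H by (intro power_le_one) auto
      show "exp (- (real m / H)) \<le> exp (- (real K / (2 * H)))"
        using m H by (simp add: field_simps)
      have "(H + 2 * real J) / T\<^sup>2 \<le> 2 * T / T\<^sup>2"
        using H by (intro divide_right_mono) (auto simp: T_def)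
      also have "\<dots> = 2 / T"
        by (simp add: power2_eq_square)
      also have "\<dots> \<le> 4 / real K"
        using T \<open>K > 0\<close> by (simp add: field_simps)
      finally show "(H + 2 * real J) / T\<^sup>2 \<le> 4 / real K" .
    qed (use r c H in auto)
    finally show ?thesis
      by simp
  qed
qed

section \<open>Convergence of same-sample stochastic extragradient\<close>

theorem corollaryE6:
  fixes M :: "'a measure"
    and \<xi> :: "nat \<Rightarrow> 'a \<Rightarrow> nat"
    and n K :: nat
    and Fs :: "nat \<Rightarrow> real ^ 'd \<Rightarrow> real ^ 'd"
    and L \<mu> :: "nat \<Rightarrow> real"
    and \<gamma>1 \<gamma>2 :: "nat \<Rightarrow> nat \<Rightarrow> real"
    and xs x0 :: "real ^ 'd"
  assumes "n \<ge> 1"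
    and zero: "mean_op n Fs xs = 0"
    and L_pos: "\<And>i. i \<in> {1..n} \<Longrightarrow> L i > 0"
    and lip: "\<And>i. i \<in> {1..n} \<Longrightarrow> (L i)-lipschitz_on UNIV (Fs i)"
    and mono: "\<And>i x. i \<in> {1..n} \<Longrightarrow>
                 (Fs i x - Fs i xs) \<bullet> (x - xs) \<ge> \<mu> i * (norm (x - xs))\<^sup>2"
    and mu_L: "\<And>i. i \<in> {1..n} \<Longrightarrow> \<bar>\<mu> i\<bar> \<le> L i"
    and mu_bar_pos: "mu_bar n \<mu> > 0"
    and prob: "prob_space M"
    and indep: "prob_space.indep_vars M (\<lambda>_. count_space {1..n}) \<xi> UNIV"
    and distr: "\<And>k i. i \<in> {1..n} \<Longrightarrow>
                 measure M {\<omega> \<in> space M. \<xi> k \<omega> = i} = L i / (\<Sum>j=1..n. L j)"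
    and gamma1: "\<And>k i. \<gamma>1 k i = beta_schedule (mean_L n L) (mu_bar n \<mu>) K k / (6 * L i)"
    and gamma2: "\<And>k i. \<gamma>2 k i = (1 / 4) * \<gamma>1 k i"
  shows "(\<integral>\<omega>. (norm (S_SEG Fs \<gamma>1 \<gamma>2 x0 (\<lambda>k. \<xi> k \<omega>) K - xs))\<^sup>2 \<partial>M)
         \<le> 1536 * mean_L n L * (norm (x0 - xs))\<^sup>2 / mu_bar n \<mu>
               * exp (- (mu_bar n \<mu> * real K / (96 * mean_L n L)))
           + 1728 * sigma_IS_sq n L Fs xs / ((mu_bar n \<mu>)\<^sup>2 * real K)"
proof -
  interpret prob_space M
    by (rule prob)
  define Lb mb where "Lb = mean_L n L" and "mb = mu_bar n \<mu>"
  define \<sigma> where "\<sigma> = sigma_IS_sq n L Fs xs"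
  define H where "H = 24 * Lb / mb"
  define c where "c = \<sigma> / (36 * Lb\<^sup>2)"
  define \<beta> where "\<beta> = beta_schedule Lb mb K"
  define it where "it s k = S_SEG Fs \<gamma>1 \<gamma>2 x0 s k" for s k
  define r where "r k = expectation (\<lambda>\<omega>. (norm (it (\<lambda>j. \<xi> j \<omega>) k - xs))\<^sup>2)" for k
  have "Lb > 0" "mb > 0" "mb \<le> Lb"
    using mean_L_pos[of n L] mu_bar_le_mean_L[of n \<mu> L] \<open>n \<ge> 1\<close> L_pos mu_L mu_bar_pos
    by (auto simp: Lb_def mb_def)
  have "\<sigma> \<ge> 0"
    unfolding \<sigma>_def sigma_IS_sq_def Lb_def[symmetric]
    using L_pos \<open>n \<ge> 1\<close> \<open>Lb > 0\<close> by (intro mult_nonneg_nonneg sum_nonneg divide_nonneg_pos) auto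
  have c: "c \<ge> 0"
    using \<open>\<sigma> \<ge> 0\<close> by (simp add: c_def)
  have past: "it (\<lambda>j. \<xi> j \<omega>) k = it (restrict (\<lambda>j. \<xi> j \<omega>) {..<k}) k" for k \<omega>
    unfolding it_def by (rule S_SEG_cong) simp
  have rec: "r (Suc k) \<le> (1 - \<beta> k / H) * r k + c * (\<beta> k)\<^sup>2" for k
  proof -
    define hist where "hist \<omega> = restrict (\<lambda>j. \<xi> j \<omega>) {..<k}" for \<omega>
    define \<phi> where "\<phi> x i
      = (norm (x - (\<gamma>1 k i / 4) *\<^sub>R Fs i (x - \<gamma>1 k i *\<^sub>R Fs i x) - xs))\<^sup>2" for x i
    have int_dist: "integrable M (\<lambda>\<omega>. (norm (it (hist \<omega>) k - xs))\<^sup>2)"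
      unfolding hist_def
      by (rule integrable_past[OF indep, where h = "\<lambda>s. (norm (it s k - xs))\<^sup>2"]) simp
    have int_\<phi>: "integrable M (\<lambda>\<omega>. \<phi> (it (hist \<omega>) k) i)" for i
      unfolding hist_def by (rule integrable_past[OF indep, where h = "\<lambda>s. \<phi> (it s k) i"]) simp
    have "r (Suc k) = expectation (\<lambda>\<omega>. \<phi> (it (hist \<omega>) k) (\<xi> k \<omega>))"
      unfolding r_def hist_def past[symmetric]
      by (simp add: \<phi>_def it_def Let_def gamma2)
    also have "\<dots> = (\<Sum>i=1..n. prob {\<omega> \<in> space M. \<xi> k \<omega> = i}
        * expectation (\<lambda>\<omega>. \<phi> (it (hist \<omega>) k) i))"
      unfolding hist_def
      by (rule expectation_fresh_sample[OF indep, where f = "\<lambda>s. \<phi> (it s k)"]) simp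
    also have "\<dots> = expectation (\<lambda>\<omega>. \<Sum>i=1..n. L i / (\<Sum>j=1..n. L j) * \<phi> (it (hist \<omega>) k) i)"
      using int_\<phi> by (subst Bochner_Integration.integral_sum) (auto simp: distr intro!: sum.cong)
    also have "\<dots> \<le> expectation (\<lambda>\<omega>. (1 - \<beta> k / H) * (norm (it (hist \<omega>) k - xs))\<^sup>2 + c * (\<beta> k)\<^sup>2)"
    proof (rule integral_mono)
      show "(\<Sum>i=1..n. L i / (\<Sum>j=1..n. L j) * \<phi> (it (hist \<omega>) k) i)
          \<le> (1 - \<beta> k / H) * (norm (it (hist \<omega>) k - xs))\<^sup>2 + c * (\<beta> k)\<^sup>2" for \<omega>
        using importance_sampled_step[OF \<open>n \<ge> 1\<close> zero L_pos lip mono mu_L _ _ gamma1]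
          beta_schedule_bounds[OF \<open>Lb > 0\<close> \<open>mb > 0\<close>]
        by (simp add: \<phi>_def \<beta>_def H_def c_def \<sigma>_def Lb_def mb_def)
    qed (auto intro!: Bochner_Integration.integrable_sum Bochner_Integration.integrable_add
          integrable_mult_right int_dist int_\<phi>)
    also have "\<dots> = (1 - \<beta> k / H) * expectation (\<lambda>\<omega>. (norm (it (hist \<omega>) k - xs))\<^sup>2) + c * (\<beta> k)\<^sup>2"
      using int_dist by (simp add: prob_space)
    also have "expectation (\<lambda>\<omega>. (norm (it (hist \<omega>) k - xs))\<^sup>2) = r k"
      unfolding r_def hist_def past[symmetric] ..
    finally show ?thesis .
  qed
  have "r K \<le> exp (- (real K / (2 * H))) * r 0 + 64 * H\<^sup>2 * c / real K"
    unfolding H_def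
    by (rule beta_schedule_recursion[OF \<open>mb > 0\<close> \<open>mb \<le> Lb\<close> c])
       (use rec in \<open>auto simp: r_def \<beta>_def H_def intro!: integral_nonneg\<close>)
  also have "r 0 = (norm (x0 - xs))\<^sup>2"
    by (simp add: r_def it_def prob_space)
  also have "exp (- (real K / (2 * H))) * (norm (x0 - xs))\<^sup>2
      \<le> 1536 * Lb * (norm (x0 - xs))\<^sup>2 / mb * exp (- (mb * real K / (96 * Lb)))"
  proof -
    have "exp (- (real K / (2 * H))) \<le> exp (- (mb * real K / (96 * Lb)))"
      using \<open>Lb > 0\<close> \<open>mb > 0\<close> by (simp add: H_def field_simps)
    moreover have "1 \<le> 1536 * Lb / mb"
      using \<open>mb > 0\<close> \<open>mb \<le> Lb\<close> by (simp add: field_simps)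
    ultimately have "1 * exp (- (real K / (2 * H)))
        \<le> 1536 * Lb / mb * exp (- (mb * real K / (96 * Lb)))"
      by (intro mult_mono) auto
    from mult_right_mono[OF this, of "(norm (x0 - xs))\<^sup>2"] show ?thesis
      by (simp add: mult_ac)
  qed
  also have "64 * H\<^sup>2 * c / real K \<le> 1728 * \<sigma> / (mb\<^sup>2 * real K)"
  proof -
    have "64 * H\<^sup>2 * c = 1024 * \<sigma> / mb\<^sup>2"
      using \<open>Lb > 0\<close> \<open>mb > 0\<close> by (simp add: H_def c_def field_simps power2_eq_square)
    also have "\<dots> \<le> 1728 * \<sigma> / mb\<^sup>2"
      using \<open>\<sigma> \<ge> 0\<close> by (intro divide_right_mono) auto
    finally show ?thesis
      using divide_right_mono[of "64 * H\<^sup>2 * c" "1728 * \<sigma> / mb\<^sup>2" "real K"] by simp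
  qed
  finally show ?thesis
    by (simp add: r_def it_def Lb_def mb_def \<sigma>_def)
qed

end
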